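(* Let $(X,d,\mu)$ be a doubling metric measure space (doubling constant $C_\mu$) with the $\delta$-annular decay property for some $\delta\in(0,1]$ (with constant $A$), and let $\Omega\subset X$ be a domain. Let $f$ be a locally bounded strongly harmonic function in $\Omega$. (i) If $\delta\in(0,1)$, then $f$ is $\delta$-Hölder continuous on every ball $B:=B(x_0,r)\subset\Omega$ centered at $x_0\in\Omega$ with $B(x_0,3r)\Subset\Omega$. If $\delta=1$, then $f$ is locally Lipschitz continuous on every such ball. In both cases $$|f(x)-f(y)|\le 4\cdot 9^\delta\,\|f\|_{L^\infty(B(x_0,3r))}\,C_\mu^3A\left(\frac{d(x,y)}{r}\right)^\delta\quad\text{for } x,y\in B(x_0,\tfrac r2).$$ (ii) Let $K\Subset\Omega$ be compact, let $f$ be bounded in $\Omega$, and let $\eta$ be a Lebesgue number of any, but fixed, open cover of $K$. Then for $x,y\in K$, $$|f(x)-f(y)|\le 4\cdot 9^\delta\|f\|_{L^\infty(\Omega)}C_\mu^3A\left(\frac{2}{\operatorname{dist}(K,\partial\Omega)}\right)^\delta d(x,y)^\delta\quad\text{if } d(x,y)\le\eta,$$ $$|f(x)-f(y)|\le 2\,\frac{\|f\|_{L^\infty(\Omega)}}{\eta^\delta}\,d(x,y)^\delta\quad\text{if } d(x,y)>\eta.$$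
   Context: Standing assumptions: $\mu$ is Borel regular, $0<\mu(B)<\infty$ for every ball $B$, and $X$ is proper. A domain is an open connected set; $A'\Subset\Omega$ means that the closure of $A'$ is a compact subset of $\Omega$. $\mu$ is doubling if $\mu(B(x,2r))\le C_\mu\mu(B(x,r))$ for all balls. $X$ (with doubling $\mu$) has the $\delta$-annular decay property, $\delta\in(0,1]$, if there is $A\ge1$ such that $\mu(B(x,r)\setminus B(x,r(1-\epsilon)))\le A\,\epsilon^\delta\mu(B(x,r))$ for all $x\in X$, $r>0$, $\epsilon\in(0,1)$. A locally integrable $f:\Omega\to\mathbb{R}$ is strongly harmonic in $\Omega$ if $f(x)=\frac{1}{\mu(B(x,r))}\int_{B(x,r)}f\,d\mu$ for all $x\in\Omega$, $r>0$ with $B(x,r)\Subset\Omega$.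
   Formalization: In (ii), dist(K,∂Ω) is read as the distance from K to the complement X∖Ω (2/dist is 0 if Ω = X); the two agree in length spaces, but with the topological boundary the estimate fails in some proper doubling spaces where balls leave Ω without meeting ∂Ω. *)

theory Defs
  imports "HOL-Analysis.Analysis" "HOL-Probability.Essential_Supremum"
begin

text \<open>
  Proper metric spaces (closed bounded sets are compact) are the types of class
  \<^class>\<open>heine_borel\<close>. All balls are open, and all radii are positive.

  A Borel regular (outer) measure is represented by its restriction to a sigma-algebra
  \<^term>\<open>sets M\<close> of measurable sets that contains the Borel sets. Both the Borel sigma-algebra
  and the larger sigma-algebra of all Caratheodory-measurable sets are allowed.
\<close>

definition borel_regular :: "'a::topological_space measure \<Rightarrow> bool" where
  "borel_regular M \<longleftrightarrow>
     space M = UNIV \<and> sets borel \<subseteq> sets M \<and>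
     (\<forall>E\<in>sets M. \<exists>B\<in>sets borel. E \<subseteq> B \<and> emeasure M B = emeasure M E)"

definition metric_measure_space :: "'a::metric_space measure \<Rightarrow> bool" where
  "metric_measure_space M \<longleftrightarrow>
     borel_regular M \<and> (\<forall>x r. 0 < r \<longrightarrow> 0 < emeasure M (ball x r) \<and> emeasure M (ball x r) < \<infinity>)"

definition doubling :: "'a::metric_space measure \<Rightarrow> real \<Rightarrow> bool" where
  "doubling M C \<longleftrightarrow>
     (\<forall>x r. 0 < r \<longrightarrow> measure M (ball x (2 * r)) \<le> C * measure M (ball x r))"

definition annular_decay :: "'a::metric_space measure \<Rightarrow> real \<Rightarrow> real \<Rightarrow> bool" where
  "annular_decay M \<delta> A \<longleftrightarrow>
     0 < \<delta> \<and> \<delta> \<le> 1 \<and> 1 \<le> A \<and>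
     (\<forall>x r \<epsilon>. 0 < r \<longrightarrow> 0 < \<epsilon> \<longrightarrow> \<epsilon> < 1 \<longrightarrow>
        measure M (ball x r - ball x (r * (1 - \<epsilon>))) \<le> A * \<epsilon> powr \<delta> * measure M (ball x r))"

definition domain :: "'a::topological_space set \<Rightarrow> bool" where
  "domain \<Omega> \<longleftrightarrow> open \<Omega> \<and> connected \<Omega>"

definition compactly_inside :: "'a::topological_space set \<Rightarrow> 'a set \<Rightarrow> bool"  (infix "\<Subset>" 50) where
  "S \<Subset> \<Omega> \<longleftrightarrow> compact (closure S) \<and> closure S \<subseteq> \<Omega>"

definition locally_integrable_on :: "'a::metric_space measure \<Rightarrow> 'a set \<Rightarrow> ('a \<Rightarrow> real) \<Rightarrow> bool" where
  "locally_integrable_on M \<Omega> f \<longleftrightarrow>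
     (\<forall>x\<in>\<Omega>. \<exists>r>0. ball x r \<subseteq> \<Omega> \<and> set_integrable M (ball x r) f)"

definition locally_bounded_on :: "'a::metric_space set \<Rightarrow> ('a \<Rightarrow> real) \<Rightarrow> bool" where
  "locally_bounded_on \<Omega> f \<longleftrightarrow> (\<forall>x\<in>\<Omega>. \<exists>r>0. ball x r \<subseteq> \<Omega> \<and> bounded (f ` ball x r))"

definition strongly_harmonic_on :: "'a::metric_space measure \<Rightarrow> 'a set \<Rightarrow> ('a \<Rightarrow> real) \<Rightarrow> bool" where
  "strongly_harmonic_on M \<Omega> f \<longleftrightarrow>
     locally_integrable_on M \<Omega> f \<and>
     (\<forall>x\<in>\<Omega>. \<forall>r>0. ball x r \<Subset> \<Omega> \<longrightarrow>
        f x = 1 / measure M (ball x r) * set_lebesgue_integral M (ball x r) f)"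

definition holder_continuous_on :: "real \<Rightarrow> 'a::metric_space set \<Rightarrow> ('a \<Rightarrow> real) \<Rightarrow> bool" where
  "holder_continuous_on \<delta> S f \<longleftrightarrow>
     (\<exists>L\<ge>0. \<forall>x\<in>S. \<forall>y\<in>S. \<bar>f x - f y\<bar> \<le> L * dist x y powr \<delta>)"

definition locally_lipschitz_on :: "'a::metric_space set \<Rightarrow> ('a \<Rightarrow> real) \<Rightarrow> bool" where
  "locally_lipschitz_on S f \<longleftrightarrow> (\<forall>x\<in>S. \<exists>r>0. \<exists>L. L-lipschitz_on (ball x r \<inter> S) f)"

text \<open>
  The \<open>L\<^sup>\<infinity>\<close> norm over \<open>S\<close> as a real number. It is only meaningful for essentially
  bounded measurable functions (an infinite value would be mapped to 0).
\<close>

definition Linf_norm :: "'a measure \<Rightarrow> 'a set \<Rightarrow> ('a \<Rightarrow> real) \<Rightarrow> real" where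
  "Linf_norm M S f = real_of_ereal (esssup (restrict_space M S) (\<lambda>x. ereal \<bar>f x\<bar>))"

definition open_cover :: "'a::topological_space set set \<Rightarrow> 'a set \<Rightarrow> bool" where
  "open_cover \<C> K \<longleftrightarrow> (\<forall>U\<in>\<C>. open U) \<and> K \<subseteq> \<Union>\<C>"

definition lebesgue_number :: "'a::metric_space set set \<Rightarrow> 'a set \<Rightarrow> real \<Rightarrow> bool" where
  "lebesgue_number \<C> K \<eta> \<longleftrightarrow>
     0 < \<eta> \<and> (\<forall>T. T \<subseteq> K \<longrightarrow> diameter T < \<eta> \<longrightarrow> (\<exists>U\<in>\<C>. T \<subseteq> U))"

text \<open>
  The distance from \<open>K\<close> to the boundary of \<open>\<Omega>\<close> is read as the distance from \<open>K\<close> to the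
  complement of \<open>\<Omega>\<close>. It is the largest \<open>R\<close> such that
  all balls \<open>B(x,R)\<close> with centre in \<open>K\<close> stay inside \<open>\<Omega>\<close> (if \<open>\<Omega>\<close> is not the whole space). For
  length spaces, in particular for normed spaces, it is the distance to the topological frontier,
  see \<open>boundary_dist_eq_setdist_frontier\<close> below. In a general metric space, a ball around a point of
  \<open>\<Omega>\<close> may leave \<open>\<Omega>\<close> without meeting the frontier, and then the distance to the frontier says
  nothing about the balls on which a function in \<open>\<Omega>\<close> has the mean value property.

  If \<open>\<Omega>\<close> is the whole space, the distance is infinite by the usual convention, whereas
  \<^const>\<open>setdist\<close> is 0. The distance is only used in the form \<open>2 / boundary_dist K \<Omega>\<close>; both
  conventions give the value 0 for this quotient.
\<close>

definition boundary_dist :: "'a::metric_space set \<Rightarrow> 'a set \<Rightarrow> real" where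
  "boundary_dist K \<Omega> = setdist K (- \<Omega>)"

text \<open>
  The assumption \<open>len\<close> holds in every length space: take for \<open>S\<close> the image of a curve from \<open>x\<close> to
  \<open>y\<close> of length at most \<open>dist x y + e\<close>.
\<close>

lemma boundary_dist_eq_setdist_frontier:
  fixes K \<Omega> :: "'a::metric_space set"
  assumes len: "\<And>(x::'a) y e. 0 < e \<Longrightarrow>
      \<exists>S. connected S \<and> x \<in> S \<and> y \<in> S \<and> S \<subseteq> cball x (dist x y + e)"
    and "open \<Omega>" and "K \<subseteq> \<Omega>"
  shows "boundary_dist K \<Omega> = setdist K (frontier \<Omega>)"
proof (cases "K = {} \<or> - \<Omega> = {}")
  case True
  then show ?thesis
  proof
    assume "- \<Omega> = {}"
    then have "\<Omega> = UNIV" by blast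
    then show ?thesis by (simp add: boundary_dist_def)
  qed (simp add: boundary_dist_def)
next
  case False
  have sub: "frontier \<Omega> \<subseteq> - \<Omega>"
    using \<open>open \<Omega>\<close> by (auto simp: frontier_def interior_open)
  have step: "\<exists>z\<in>frontier \<Omega>. dist x z \<le> dist x y + e"
    if "x \<in> K" "y \<in> - \<Omega>" "0 < e" for x y e
  proof -
    from len[OF \<open>0 < e\<close>, of x y] obtain S where S: "connected S" "x \<in> S" "y \<in> S"
      "S \<subseteq> cball x (dist x y + e)" by blast
    have "S \<inter> frontier \<Omega> \<noteq> {}"
      by (rule connected_Int_frontier[OF S(1)]) (use S that \<open>K \<subseteq> \<Omega>\<close> in auto)
    then show ?thesis using S(4) by auto
  qed
  have ne: "frontier \<Omega> \<noteq> {}"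
    using False step[of _ _ 1] by fastforce
  show ?thesis unfolding boundary_dist_def
  proof (rule antisym)
    show "setdist K (- \<Omega>) \<le> setdist K (frontier \<Omega>)"
      by (rule setdist_subset_right[OF ne sub])
    show "setdist K (frontier \<Omega>) \<le> setdist K (- \<Omega>)"
    proof (rule le_setdistI)
      fix x y assume xy: "x \<in> K" "y \<in> - \<Omega>"
      show "setdist K (frontier \<Omega>) \<le> dist x y"
      proof (rule field_le_epsilon)
        fix e :: real assume "0 < e"
        then obtain z where "z \<in> frontier \<Omega>" "dist x z \<le> dist x y + e" using step xy by blast
        then show "setdist K (frontier \<Omega>) \<le> dist x y + e"
          using setdist_le_dist[OF xy(1), of z] by fastforce
      qed
    qed (use False in auto)
  qed
qed

end

theory Submission
  imports Defs
begin

text \<open>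
  Subtract the mean values of \<open>f\<close> over the balls \<open>B(x,R)\<close> and \<open>B(y,R)\<close>. Their symmetric difference
  lies in two annuli of width \<open>d(x,y)\<close>, so annular decay gives
  \<open>\<bar>f x - f y\<bar> \<le> 3 \<parallel>f\<parallel>\<^sub>\<infinity> A (d(x,y)/R)\<^sup>\<delta>\<close>. Comparing with the larger of the two balls avoids the
  doubling constant. For (i) take \<open>R = 2r\<close>, for (ii) take half the distance of \<open>K\<close> to the
  complement of \<open>\<Omega>\<close>, or let \<open>R\<close> tend to infinity if \<open>\<Omega>\<close> is the whole space.
\<close>

section \<open>Measurability from local integrability\<close>

text \<open>In a proper space the points of a closed ball of radius \<open>n\<close> that keep
  distance at least \<open>1 / (n + 1)\<close> from the complement form a compact set, and these
  sets exhaust an open set.\<close>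

lemma open_heine_borel_sigma_compact:
  fixes U :: "'a::heine_borel set"
  assumes "open U"
  obtains K :: "nat \<Rightarrow> 'a set" where "\<And>n. compact (K n)" "U = (\<Union>n. K n)"
proof -
  fix a :: 'a
  \<comment> \<open>Each point \<open>w\<close> of the complement gives its own condition, so for an
    empty complement the intersection is the whole space. A bound on \<open>setdist\<close> would
    fail there, since that distance is 0 by convention.\<close>
  define K where "K n = cball a (real n) \<inter> (\<Inter>w\<in>-U. {z. 1 / real (Suc n) \<le> dist z w})" for n
  have "closed {z. 1 / real (Suc n) \<le> dist z w}" for n and w :: 'a
    by (intro closed_Collect_le continuous_intros)
  then have "compact (K n)" for n
    unfolding K_def by (intro compact_Int_closed closed_INT ballI compact_cball)
  moreover have "U = (\<Union>n. K n)"
  proof (intro equalityI subsetI)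
    fix x assume "x \<in> U"
    then obtain e where e: "e > 0" "ball x e \<subseteq> U" using assms open_contains_ball by blast
    \<comment> \<open>\<open>n1\<close> handles the distance to the complement, \<open>n2\<close>
      the distance to the centre \<open>a\<close>; their maximum serves for both.\<close>
    obtain n1 where n1: "1 / real (Suc n1) < e" using nat_approx_posE[OF e(1)] by metis
    obtain n2 where n2: "dist a x \<le> real n2" using real_arch_simple by blast
    have "1 / real (Suc (max n1 n2)) \<le> 1 / real (Suc n1)"
      by (intro divide_left_mono) auto
    then have "1 / real (Suc (max n1 n2)) \<le> e" using n1 by linarith
    moreover have "e \<le> dist x w" if "w \<notin> U" for w
      using e(2) that by (meson in_mono mem_ball not_le)
    ultimately have "x \<in> K (max n1 n2)" using n2 unfolding K_def by fastforce
    then show "x \<in> (\<Union>n. K n)" by blast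
  next
    fix x assume "x \<in> (\<Union>n. K n)"
    then obtain n where "x \<in> K n" by blast
    then have "1 / real (Suc n) \<le> dist x w" if "w \<notin> U" for w
      using that unfolding K_def by blast
    moreover have "0 < 1 / real (Suc n)" by simp
    ultimately show "x \<in> U" by (metis dist_self not_le)
  qed
  ultimately show ?thesis using that by blast
qed

text \<open>Each point has a ball on which \<open>f\<close> is integrable, hence measurable; by
  \<sigma>-compactness countably many such balls cover \<open>S\<close>, and measurability can be
  glued along a countable cover. It is what makes \<open>Linf_norm M S f\<close> meaningful for a
  strongly harmonic \<open>f\<close>.\<close>

lemma locally_integrable_on_measurable:
  fixes f :: "'a::heine_borel \<Rightarrow> real"
  assumes M: "space M = UNIV" "sets borel \<subseteq> sets M"
    and "open \<Omega>" "open S" "S \<subseteq> \<Omega>" and f: "locally_integrable_on M \<Omega> f"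
  shows "f \<in> borel_measurable (restrict_space M S)"
proof -
  have os: "U \<in> sets M" if "open U" for U using that M(2) borel_open by blast
  obtain K :: "nat \<Rightarrow> 'a set" where K: "\<And>n. compact (K n)" "S = (\<Union>n. K n)"
    using open_heine_borel_sigma_compact[OF \<open>open S\<close>] by metis
  have "\<forall>x\<in>S. \<exists>r>0. set_integrable M (ball x r) f"
    using f \<open>S \<subseteq> \<Omega>\<close> unfolding locally_integrable_on_def by blast
  then obtain r where r: "\<And>x. x \<in> S \<Longrightarrow> r x > 0" "\<And>x. x \<in> S \<Longrightarrow> set_integrable M (ball x (r x)) f"
    by metis
  have "\<exists>F. finite F \<and> F \<subseteq> K n \<and> K n \<subseteq> (\<Union>x\<in>F. ball x (r x))" for n
  proof -
    have "K n \<subseteq> (\<Union>x\<in>K n. ball x (r x))" using r(1) K(2) by force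
    then obtain F where "F \<subseteq> K n" "finite F" "K n \<subseteq> (\<Union>x\<in>F. ball x (r x))"
      by (rule compactE_image[OF K(1) open_ball])
    then show ?thesis by blast
  qed
  then obtain F where F: "\<And>n. finite (F n)" "\<And>n. F n \<subseteq> K n"
    "\<And>n. K n \<subseteq> (\<Union>x\<in>F n. ball x (r x))" by metis
  show ?thesis
  proof (rule measurable_piecewise_restrict)
    show "countable ((\<lambda>x. ball x (r x)) ` (\<Union>n. F n))"
      using F(1) by (intro countable_image countable_UN) (auto intro: countable_finite)
    have "S \<subseteq> (\<Union>n. \<Union>x\<in>F n. ball x (r x))"
      unfolding K(2) using F(3) by (intro UN_mono) auto
    then show "space (restrict_space M S) \<subseteq> \<Union>((\<lambda>x. ball x (r x)) ` (\<Union>n. F n))"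
      by (auto simp: space_restrict_space M)
  next
    fix B assume "B \<in> (\<lambda>x. ball x (r x)) ` (\<Union>n. F n)"
    then obtain x where x: "x \<in> S" "B = ball x (r x)" using F(2) K(2) by blast
    show "B \<inter> space (restrict_space M S) \<in> sets (restrict_space M S)"
      using x os \<open>open S\<close> by (auto simp: sets_restrict_space_iff space_restrict_space M)
    \<comment> \<open>The ball \<open>B\<close> may leave \<open>S\<close>, so integrability is
      first cut down to the intersection.\<close>
    have "set_integrable M (B \<inter> S) f"
      by (rule set_integrable_subset[OF r(2)[OF x(1)]]) (use x os \<open>open S\<close> in auto)
    then have "f \<in> borel_measurable (restrict_space M (B \<inter> S))"
      unfolding set_integrable_def using os x \<open>open S\<close>
      by (subst borel_measurable_restrict_space_iff) (auto simp: M)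
    then show "f \<in> borel_measurable (restrict_space (restrict_space M S) B)"
      using os x \<open>open S\<close> by (subst restrict_restrict_space) (auto simp: M Int_commute)
  qed
qed

section \<open>Essential bounds and the difference of two averages\<close>

text \<open>Boundedness excludes the value \<infinity> of the essential supremum, which
  \<open>real_of_ereal\<close> would turn into 0.\<close>

lemma AE_abs_le_Linf_norm:
  assumes "S \<inter> space M \<in> sets M" "f \<in> borel_measurable (restrict_space M S)" "bounded (f ` S)"
  shows "AE x in M. x \<in> S \<longrightarrow> \<bar>f x\<bar> \<le> Linf_norm M S f"
proof -
  define E where "E = esssup (restrict_space M S) (\<lambda>x. ereal \<bar>f x\<bar>)"
  obtain c where c: "\<And>x. x \<in> S \<Longrightarrow> \<bar>f x\<bar> \<le> c"
    using assms(3) by (auto simp: bounded_iff)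
  have "E \<le> ereal c"
    unfolding E_def using assms(2) c
    by (intro esssup_I) (auto simp: space_restrict_space intro!: AE_I2)
  moreover have "AE x in restrict_space M S. ereal \<bar>f x\<bar> \<le> E"
    unfolding E_def by (rule esssup_AE)
  then have "AE x in M. x \<in> S \<longrightarrow> ereal \<bar>f x\<bar> \<le> E"
    by (simp add: AE_restrict_space_iff[OF assms(1)])
  \<comment> \<open>If \<open>E\<close> is -\<infinity>, the almost everywhere bound by
    \<open>E\<close> forces \<open>S\<close> to be a null set, and the claim is vacuous.\<close>
  ultimately show ?thesis
    unfolding Linf_norm_def E_def[symmetric] by (cases E) auto
qed

lemma set_integrable_bounded:
  fixes f :: "'a \<Rightarrow> real"
  assumes "X \<in> sets M" "X \<subseteq> S" "S \<inter> space M \<in> sets M" "f \<in> borel_measurable (restrict_space M S)"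
    and "emeasure M X < \<infinity>" "bounded (f ` S)"
  shows "set_integrable M X f"
proof -
  obtain c where c: "\<And>x. x \<in> S \<Longrightarrow> \<bar>f x\<bar> \<le> c"
    using assms(6) by (auto simp: bounded_iff)
  have "f \<in> borel_measurable (restrict_space (restrict_space M S) X)"
    using assms(4) by (rule measurable_restrict_space1)
  moreover have "S \<inter> X = X" using assms(2) by blast
  ultimately have "f \<in> borel_measurable (restrict_space M X)"
    using assms(1,3) by (subst (asm) restrict_restrict_space) auto
  then have "set_borel_measurable M X f"
    unfolding set_borel_measurable_def using assms(1)
    by (subst (asm) borel_measurable_restrict_space_iff) auto
  then show ?thesis
    unfolding set_integrable_def set_borel_measurable_def
    by (intro integrableI_bounded_set[where A = X and B = c])
       (use assms(1,2,5) c in \<open>auto intro!: AE_I2\<close>)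
qed

lemma set_integral_abs_le:
  fixes f :: "'a \<Rightarrow> real"
  assumes "X \<in> sets M" "emeasure M X < \<infinity>" "set_integrable M X f"
    and "AE x in M. x \<in> X \<longrightarrow> \<bar>f x\<bar> \<le> N"
  shows "\<bar>set_lebesgue_integral M X f\<bar> \<le> N * measure M X"
proof -
  have "\<bar>set_lebesgue_integral M X f\<bar> \<le> (\<integral>x. \<bar>indicator X x *\<^sub>R f x\<bar> \<partial>M)"
    unfolding set_lebesgue_integral_def by (rule integral_abs_bound)
  also have "\<dots> \<le> (\<integral>x. indicator X x *\<^sub>R N \<partial>M)"
  proof (rule integral_mono_AE)
    show "integrable M (\<lambda>x. \<bar>indicator X x *\<^sub>R f x\<bar>)"
      using assms(3) unfolding set_integrable_def by (rule integrable_abs)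
    show "integrable M (\<lambda>x. indicator X x *\<^sub>R N)"
      using assms(1,2) by (intro integrable_scaleR_left integrable_real_indicator) auto
    show "AE x in M. \<bar>indicator X x *\<^sub>R f x\<bar> \<le> indicator X x *\<^sub>R N"
      using assms(4) by eventually_elim (auto simp: indicator_def)
  qed
  also have "\<dots> = N * measure M X"
    using set_integral_const[of X M N] assms(1,2) by (simp add: set_lebesgue_integral_def)
  finally show ?thesis .
qed

lemma set_integral_diff_split:
  fixes f :: "'a \<Rightarrow> real"
  assumes "X \<in> sets M" "Y \<in> sets M" "set_integrable M X f"
  shows "set_lebesgue_integral M X f =
    set_lebesgue_integral M (X - Y) f + set_lebesgue_integral M (X \<inter> Y) f"
proof -
  have "set_lebesgue_integral M ((X - Y) \<union> (X \<inter> Y)) f =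
      set_lebesgue_integral M (X - Y) f + set_lebesgue_integral M (X \<inter> Y) f"
    by (intro set_integral_Un set_integrable_subset[OF assms(3)]) (use assms in auto)
  moreover have "(X - Y) \<union> (X \<inter> Y) = X" by blast
  ultimately show ?thesis by simp
qed

text \<open>By symmetry let \<open>X\<close> be the larger set. The integrals over \<open>X\<close>
  and \<open>Y\<close> differ only by those over \<open>X - Y\<close> and \<open>Y - X\<close>,
  which contributes \<open>2 * N * e\<close> after division by the measure of \<open>X\<close>;
  changing the normalisation from \<open>Y\<close> to \<open>X\<close> costs another
  \<open>N * e\<close>.\<close>

lemma average_diff_le:
  fixes f :: "'a \<Rightarrow> real"
  assumes X: "X \<in> sets M" "emeasure M X < \<infinity>" "set_integrable M X f" "0 < measure M X"
    and Y: "Y \<in> sets M" "emeasure M Y < \<infinity>" "set_integrable M Y f" "0 < measure M Y"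
    and N: "AE x in M. x \<in> X \<union> Y \<longrightarrow> \<bar>f x\<bar> \<le> N" "0 \<le> N"
    and dX: "measure M (X - Y) \<le> e * measure M X" and dY: "measure M (Y - X) \<le> e * measure M Y"
  shows "\<bar>1 / measure M X * set_lebesgue_integral M X f
          - 1 / measure M Y * set_lebesgue_integral M Y f\<bar> \<le> 3 * N * e"
proof -
  have main: "\<bar>1 / measure M X * set_lebesgue_integral M X f
          - 1 / measure M Y * set_lebesgue_integral M Y f\<bar> \<le> 3 * N * e"
    if X: "X \<in> sets M" "emeasure M X < \<infinity>" "set_integrable M X f" "0 < measure M X"
      and Y: "Y \<in> sets M" "emeasure M Y < \<infinity>" "set_integrable M Y f" "0 < measure M Y"
      and N1: "AE x in M. x \<in> X \<union> Y \<longrightarrow> \<bar>f x\<bar> \<le> N"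
      and dX: "measure M (X - Y) \<le> e * measure M X"
      and dY: "measure M (Y - X) \<le> e * measure M Y"
      and le: "measure M Y \<le> measure M X" for X Y
  proof -
    define a b I J where "a = measure M X" and "b = measure M Y"
      and "I = set_lebesgue_integral M X f" and "J = set_lebesgue_integral M Y f"
    have sub: "\<bar>set_lebesgue_integral M Z f\<bar> \<le> N * measure M Z"
      if "Z \<subseteq> W" "Z \<in> sets M" "W = X \<or> W = Y" for Z W
    proof (rule set_integral_abs_le)
      have W: "W \<in> sets M" "emeasure M W < \<infinity>" "set_integrable M W f" using that X Y by auto
      show "emeasure M Z < \<infinity>" using emeasure_mono[OF \<open>Z \<subseteq> W\<close> W(1)] W(2) by (rule le_less_trans)
      show "set_integrable M Z f" using set_integrable_subset[OF W(3)] that by blast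
      show "AE x in M. x \<in> Z \<longrightarrow> \<bar>f x\<bar> \<le> N"
        using N1 by eventually_elim (use that in blast)
    qed fact
    \<comment> \<open>The sign of \<open>e\<close> follows from \<open>dX\<close>, because
      \<open>X\<close> has positive measure.\<close>
    have e0: "0 \<le> e" using dX X(4) measure_nonneg[of M "X - Y"]
      by (meson order_trans zero_le_mult_iff not_le)
    have p: "0 < a" "0 < b" "b \<le> a" using X(4) Y(4) le by (auto simp: a_def b_def)
    have J: "\<bar>J\<bar> \<le> N * b" unfolding J_def b_def by (rule sub[of Y Y]) (use Y in auto)
    have "I - J = set_lebesgue_integral M (X - Y) f - set_lebesgue_integral M (Y - X) f"
      unfolding I_def J_def
      using set_integral_diff_split[OF X(1) Y(1) X(3)] set_integral_diff_split[OF Y(1) X(1) Y(3)]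
      by (simp add: Int_commute)
    moreover have "\<bar>set_lebesgue_integral M (X - Y) f\<bar> \<le> N * measure M (X - Y)"
      by (rule sub[of _ X]) (use X Y in auto)
    moreover have "\<bar>set_lebesgue_integral M (Y - X) f\<bar> \<le> N * measure M (Y - X)"
      by (rule sub[of _ Y]) (use X Y in auto)
    moreover have "N * measure M (X - Y) \<le> N * (e * a)"
      using dX N(2) by (auto simp: a_def intro: mult_left_mono)
    \<comment> \<open>This is where the choice of the larger set enters: \<open>e * b\<close> is at
      most \<open>e * a\<close>.\<close>
    moreover have "measure M (Y - X) \<le> e * a"
      using dY mult_left_mono[OF p(3) e0] by (simp add: b_def)
    then have "N * measure M (Y - X) \<le> N * (e * a)"
      using N(2) by (rule mult_left_mono)
    ultimately have IJ: "\<bar>I - J\<bar> \<le> 2 * (N * (e * a))" by linarith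
    have "measure M X \<le> measure M ((X - Y) \<union> Y)"
    proof (rule measure_mono_fmeasurable)
      show "(X - Y) \<union> Y \<in> fmeasurable M"
        using X(1,2) Y(1,2) by (intro fmeasurable.Un fmeasurable_Diff fmeasurableI) auto
    qed (use X in auto)
    also have "\<dots> \<le> measure M (X - Y) + measure M Y"
      by (rule measure_Un_le) (use X Y in auto)
    finally have ab: "a - b \<le> e * a" using dX unfolding a_def b_def by linarith
    \<comment> \<open>The first term carries the change of the integral, the second the change of
      the normalisation. In the second, the factor \<open>b\<close> from the bound on
      \<open>J\<close> cancels the \<open>b\<close> of the denominator.\<close>
    have "1 / a * I - 1 / b * J = (I - J) / a - J * (a - b) / (a * b)"
      using p by (simp add: field_simps)
    then have "\<bar>1 / a * I - 1 / b * J\<bar> \<le> \<bar>I - J\<bar> / a + \<bar>J\<bar> * (a - b) / (a * b)"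
      using abs_triangle_ineq4[of "(I - J) / a" "J * (a - b) / (a * b)"] p by (simp add: abs_mult)
    also have "\<dots> \<le> 2 * (N * (e * a)) / a + N * b * (e * a) / (a * b)"
      using p IJ J ab N(2) e0
      by (intro add_mono divide_right_mono mult_mono) auto
    also have "\<dots> = 3 * N * e" using p by (simp add: field_simps)
    finally show ?thesis unfolding a_def b_def I_def J_def .
  qed
  show ?thesis
  proof (cases "measure M Y \<le> measure M X")
    case True
    show ?thesis by (rule main) (use assms True in auto)
  next
    case False
    have "\<bar>1 / measure M Y * set_lebesgue_integral M Y f
          - 1 / measure M X * set_lebesgue_integral M X f\<bar> \<le> 3 * N * e"
      by (rule main) (use assms False in \<open>auto simp: Un_commute\<close>)
    then show ?thesis by linarith
  qed
qed

section \<open>Balls in a proper metric measure space\<close>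

lemma metric_measure_spaceD:
  assumes "metric_measure_space M"
  shows "space M = UNIV" "sets borel \<subseteq> sets M"
    and "open U \<Longrightarrow> U \<in> sets M"
    and "0 < r \<Longrightarrow> emeasure M (ball x r) < \<infinity>" "0 < r \<Longrightarrow> 0 < measure M (ball x r)"
proof -
  show 1: "space M = UNIV" "sets borel \<subseteq> sets M"
    using assms by (auto simp: metric_measure_space_def borel_regular_def)
  show "open U \<Longrightarrow> U \<in> sets M" using 1(2) borel_open by blast
  show "0 < r \<Longrightarrow> emeasure M (ball x r) < \<infinity>" "0 < r \<Longrightarrow> 0 < measure M (ball x r)"
    using assms by (auto simp: metric_measure_space_def measure_def enn2real_positive_iff)
qed

text \<open>Compare the balls of radius 1 and 2 about any point: the smaller one has positive
  measure. This allows the factor \<open>C ^ 3\<close> to be inserted into an upper bound.\<close>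

lemma doubling_ge_1:
  assumes "metric_measure_space (M :: 'a::metric_space measure)" "doubling M C"
  shows "1 \<le> C"
proof -
  fix x :: 'a
  note mD = metric_measure_spaceD[OF assms(1)]
  have "measure M (ball x 1) \<le> measure M (ball x (2 * 1))"
    by (rule measure_mono_fmeasurable) (use mD in \<open>auto simp: fmeasurable_def\<close>)
  also have "\<dots> \<le> C * measure M (ball x 1)"
    using assms(2) unfolding doubling_def by (meson zero_less_one)
  finally show ?thesis using mD(5)[of 1 x] by simp
qed

lemma locally_bounded_on_compact:
  assumes "locally_bounded_on \<Omega> f" "compact K" "K \<subseteq> \<Omega>"
  shows "bounded (f ` K)"
proof -
  have "\<forall>x\<in>K. \<exists>r>0. bounded (f ` ball x r)"
    using assms(1,3) unfolding locally_bounded_on_def by blast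
  then obtain r where r: "\<And>x. x \<in> K \<Longrightarrow> r x > 0" "\<And>x. x \<in> K \<Longrightarrow> bounded (f ` ball x (r x))"
    by metis
  have "K \<subseteq> (\<Union>x\<in>K. ball x (r x))" using r(1) by force
  then obtain F where F: "F \<subseteq> K" "finite F" "K \<subseteq> (\<Union>x\<in>F. ball x (r x))"
    by (rule compactE_image[OF assms(2) open_ball])
  have "bounded (\<Union>x\<in>F. f ` ball x (r x))" using F r(2) by (intro bounded_UN) auto
  then show ?thesis by (rule bounded_subset) (use F(3) in blast)
qed

lemma ball_compactly_inside:
  fixes x :: "'a::heine_borel"
  assumes "cball x R \<subseteq> \<Omega>"
  shows "ball x R \<Subset> \<Omega>"
proof -
  have "closure (ball x R) \<subseteq> cball x R" by (intro closure_minimal ball_subset_cball closed_cball)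
  then show ?thesis
    using assms by (auto simp: compactly_inside_def compact_closure)
qed

section \<open>The Hoelder estimate at a fixed radius\<close>

context
  fixes M :: "'a::heine_borel measure" and \<Omega> S :: "'a set" and f :: "'a \<Rightarrow> real"
  assumes M: "metric_measure_space M" and \<Omega>: "open \<Omega>" and f: "strongly_harmonic_on M \<Omega> f"
    and S: "open S" "S \<subseteq> \<Omega>" "bounded (f ` S)"
begin

private lemma meas: "f \<in> borel_measurable (restrict_space M S)"
  using f locally_integrable_on_measurable[OF metric_measure_spaceD(1,2)[OF M] \<Omega> S(1,2)]
  by (simp add: strongly_harmonic_on_def)

private lemma AE_le: "AE x in M. x \<in> S \<longrightarrow> \<bar>f x\<bar> \<le> Linf_norm M S f"
  using AE_abs_le_Linf_norm[OF _ meas S(3)] metric_measure_spaceD[OF M] S(1) by simp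

private lemma ball_integrable:
  "0 < R \<Longrightarrow> ball x R \<subseteq> S \<Longrightarrow> set_integrable M (ball x R) f"
  by (rule set_integrable_bounded[OF _ _ _ meas _ S(3)]) (use metric_measure_spaceD[OF M] S(1) in auto)

text \<open>The value at \<open>x\<close> is an average over a small ball inside \<open>S\<close>,
  and averages ignore null sets; so the essential bound holds at every point.\<close>

lemma strongly_harmonic_abs_le_Linf_norm:
  assumes "x \<in> S"
  shows "\<bar>f x\<bar> \<le> Linf_norm M S f"
proof -
  obtain R where R: "R > 0" "cball x R \<subseteq> S" using assms S(1) open_contains_cball by blast
  have bS: "ball x R \<subseteq> S" using R(2) ball_subset_cball by blast
  have "f x = 1 / measure M (ball x R) * set_lebesgue_integral M (ball x R) f"
    using f assms S(2) R ball_compactly_inside[of x R \<Omega>] unfolding strongly_harmonic_on_def by blast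
  moreover have "\<bar>set_lebesgue_integral M (ball x R) f\<bar> \<le> Linf_norm M S f * measure M (ball x R)"
  proof (rule set_integral_abs_le)
    show "AE z in M. z \<in> ball x R \<longrightarrow> \<bar>f z\<bar> \<le> Linf_norm M S f"
      using AE_le by eventually_elim (use bS in blast)
  qed (use metric_measure_spaceD(3,4)[OF M] R(1) ball_integrable[OF R(1) bS] in auto)
  ultimately show ?thesis
    using metric_measure_spaceD(5)[OF M R(1), of x] by (simp add: abs_mult pos_divide_le_eq)
qed

text \<open>With \<epsilon> = \<open>dist x y / R\<close>, the ball of radius
  \<open>R * (1 - \<epsilon>)\<close> about either point lies in the ball of radius \<open>R\<close>
  about the other. Annular decay therefore gives the hypotheses of \<open>average_diff_le\<close>
  with \<open>A * \<epsilon> powr \<delta>\<close> for \<open>e\<close>. The set \<open>S\<close>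
  only determines where the norm is taken: it is \<open>ball x0 (3 * r)\<close> for (i) and \<Omega>
  for (ii).\<close>

lemma strongly_harmonic_holder:
  assumes A: "annular_decay M \<delta> A" and R: "0 < R" "dist x y < R"
    and x: "ball x R \<Subset> \<Omega>" "ball x R \<subseteq> S" and y: "ball y R \<Subset> \<Omega>" "ball y R \<subseteq> S"
  shows "\<bar>f x - f y\<bar> \<le> 3 * Linf_norm M S f * A * (dist x y / R) powr \<delta>"
proof (cases "x = y")
  case False
  note mD = metric_measure_spaceD[OF M]
  have xy: "x \<in> S" "y \<in> S" using x(2) y(2) R(1) centre_in_ball by blast+
  have mv: "f z = 1 / measure M (ball z R) * set_lebesgue_integral M (ball z R) f"
    if "ball z R \<Subset> \<Omega>" "z \<in> S" for z
    using f that R(1) S(2) unfolding strongly_harmonic_on_def by blast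
  define e where "e = dist x y / R"
  \<comment> \<open>Annular decay is stated for widths strictly between 0 and 1; the lower bound is
    the reason for splitting off \<open>x = y\<close>.\<close>
  have e: "0 < e" "e < 1" using False R by (auto simp: e_def)
  have decay: "measure M (ball u R - ball v R) \<le> A * e powr \<delta> * measure M (ball u R)"
    if "dist u v = dist x y" for u v
  proof -
    have Re: "R * (1 - e) = R - dist u v" using R that by (simp add: e_def field_simps)
    have "ball u R - ball v R \<subseteq> ball u R - ball u (R * (1 - e))"
    proof (intro Diff_mono subset_refl subsetI)
      fix z assume "z \<in> ball u (R * (1 - e))"
      then show "z \<in> ball v R" using dist_triangle[of v z u] Re that by (simp add: dist_commute)
    qed
    then have "measure M (ball u R - ball v R) \<le> measure M (ball u R - ball u (R * (1 - e)))"
    proof (rule measure_mono_fmeasurable)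
      show "ball u R - ball u (R * (1 - e)) \<in> fmeasurable M"
        using mD(3,4) R(1) by (intro fmeasurable_Diff fmeasurableI) auto
    qed (use mD(3) in auto)
    also have "\<dots> \<le> A * e powr \<delta> * measure M (ball u R)"
      using A e R(1) unfolding annular_decay_def by blast
    finally show ?thesis .
  qed
  have N: "0 \<le> Linf_norm M S f" using strongly_harmonic_abs_le_Linf_norm[OF xy(1)] by linarith
  have "\<bar>f x - f y\<bar> \<le> 3 * Linf_norm M S f * (A * e powr \<delta>)"
    unfolding mv[OF x(1) xy(1)] mv[OF y(1) xy(2)]
  proof (rule average_diff_le)
    show "AE z in M. z \<in> ball x R \<union> ball y R \<longrightarrow> \<bar>f z\<bar> \<le> Linf_norm M S f"
      using AE_le by eventually_elim (use x(2) y(2) in blast)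
  qed (use mD(3,4,5) R(1) N x(2) y(2) ball_integrable decay in \<open>auto simp: dist_commute\<close>)
  then show ?thesis by (simp add: e_def mult.assoc)
qed simp

end

section \<open>A Liouville theorem and the comparison of constants\<close>

text \<open>In a proper space every ball is compactly inside \<open>UNIV\<close>, so the Hoelder
  estimate holds for all large \<open>R\<close>, and its right-hand side tends to 0. This settles
  (ii) for the whole space, where \<open>2 / boundary_dist K \<Omega>\<close> is 0.\<close>

lemma strongly_harmonic_bounded_UNIV_const:
  fixes f :: "'a::heine_borel \<Rightarrow> real"
  assumes M: "metric_measure_space M" and A: "annular_decay M \<delta> A"
    and f: "strongly_harmonic_on M UNIV f" "bounded (range f)"
  shows "f x = f y"
proof (cases "x = y")
  case False
  have \<delta>: "0 < \<delta>" using A by (simp add: annular_decay_def)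
  \<comment> \<open>The norm is taken over the whole space, so \<open>c\<close> does not change with
    \<open>R\<close>.\<close>
  define c where "c = 3 * Linf_norm M UNIV f * A"
  have "((\<lambda>R. dist x y / R) \<longlongrightarrow> 0) at_top"
    by (intro tendsto_divide_0[OF tendsto_const] filterlim_at_top_imp_at_infinity filterlim_ident)
  then have "((\<lambda>R. (dist x y / R) powr \<delta>) \<longlongrightarrow> 0) at_top"
    by (rule tendsto_zero_powrI[OF _ tendsto_const _ \<delta>])
       (auto intro!: eventually_at_top_linorderI[of 0])
  then have "((\<lambda>R. c * (dist x y / R) powr \<delta>) \<longlongrightarrow> c * 0) at_top"
    by (intro tendsto_intros)
  moreover have "\<forall>\<^sub>F R in at_top. \<bar>f x - f y\<bar> \<le> c * (dist x y / R) powr \<delta>"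
    using eventually_gt_at_top[of "dist x y"]
  proof eventually_elim
    case (elim R)
    then have R: "0 < R" using zero_le_dist[of x y] by linarith
    show ?case unfolding c_def
      by (rule strongly_harmonic_holder[OF M _ f(1) _ _ _ A R elim])
         (use f(2) in \<open>auto intro!: ball_compactly_inside\<close>)
  qed
  ultimately have "\<bar>f x - f y\<bar> \<le> c * 0"
    by (intro tendsto_lowerbound) auto
  then show ?thesis by simp
qed simp

text \<open>Both \<open>9 powr \<delta>\<close> and \<open>C ^ 3\<close> are at least 1, and powers
  with positive exponent are monotone. This turns the constant 3 of the estimate at a fixed radius
  into the stated one.\<close>

lemma holder_constant_mono:
  fixes C A N s t \<delta> :: real
  assumes "1 \<le> C" "1 \<le> A" "0 \<le> N" "0 \<le> s" "s \<le> t" "0 < \<delta>"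
  shows "3 * N * A * s powr \<delta> \<le> 4 * 9 powr \<delta> * N * C ^ 3 * A * t powr \<delta>"
proof -
  have "1 \<le> 9 powr \<delta>" using assms by (simp add: ge_one_powr_ge_zero)
  moreover have "1 \<le> C ^ 3" using assms(1) by (rule one_le_power)
  ultimately have "1 * 1 \<le> 9 powr \<delta> * C ^ 3" by (intro mult_mono) auto
  then have 1: "3 * 1 \<le> 4 * (9 powr \<delta> * C ^ 3)" by linarith
  have 2: "N * A * s powr \<delta> \<le> N * A * t powr \<delta>"
    using assms by (intro mult_left_mono powr_mono2) auto
  have 3: "0 \<le> N * A * s powr \<delta>" using assms by simp
  have "(3 * 1) * (N * A * s powr \<delta>) \<le> 4 * (9 powr \<delta> * C ^ 3) * (N * A * t powr \<delta>)"
    by (rule mult_mono[OF 1 2 _ 3]) (use 1 in linarith)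
  then show ?thesis by (simp add: mult_ac)
qed

section \<open>Hoelder bounds on balls and on compact sets\<close>

theorem theorem4p2:
  fixes M :: "'a::heine_borel measure"
    and \<Omega> :: "'a set"
    and f :: "'a \<Rightarrow> real"
    and \<delta> A C :: real
  assumes "metric_measure_space M"
    and "doubling M C"
    and "0 < \<delta>" and "\<delta> \<le> 1"
    and "annular_decay M \<delta> A"
    and "domain \<Omega>"
    and "locally_bounded_on \<Omega> f"
    and "strongly_harmonic_on M \<Omega> f"
  shows
    "(\<forall>x0\<in>\<Omega>. \<forall>r>0. ball x0 r \<subseteq> \<Omega> \<longrightarrow> ball x0 (3 * r) \<Subset> \<Omega> \<longrightarrow>
        (\<delta> < 1 \<longrightarrow> holder_continuous_on \<delta> (ball x0 r) f) \<and>
        (\<delta> = 1 \<longrightarrow> locally_lipschitz_on (ball x0 r) f) \<and>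
        (\<forall>x\<in>ball x0 (r / 2). \<forall>y\<in>ball x0 (r / 2).
           \<bar>f x - f y\<bar> \<le> 4 * 9 powr \<delta> * Linf_norm M (ball x0 (3 * r)) f * C ^ 3 * A
                          * (dist x y / r) powr \<delta>)) \<and>
     (\<forall>K \<C> \<eta>. compact K \<longrightarrow> K \<Subset> \<Omega> \<longrightarrow> bounded (f ` \<Omega>) \<longrightarrow>
        open_cover \<C> K \<longrightarrow> lebesgue_number \<C> K \<eta> \<longrightarrow>
        (\<forall>x\<in>K. \<forall>y\<in>K.
           (dist x y \<le> \<eta> \<longrightarrow>
              \<bar>f x - f y\<bar> \<le> 4 * 9 powr \<delta> * Linf_norm M \<Omega> f * C ^ 3 * A
                             * (2 / boundary_dist K \<Omega>) powr \<delta> * dist x y powr \<delta>) \<and>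
           (dist x y > \<eta> \<longrightarrow>
              \<bar>f x - f y\<bar> \<le> 2 * (Linf_norm M \<Omega> f / \<eta> powr \<delta>) * dist x y powr \<delta>)))"
proof (intro conjI ballI allI impI)
  note M = assms(1) and decay = assms(5) and harm = assms(8)
  have \<Omega>: "open \<Omega>" using assms(6) by (simp add: domain_def)
  have C: "1 \<le> C" using doubling_ge_1[OF M assms(2)] .
  have A: "1 \<le> A" using decay by (simp add: annular_decay_def)
  {
    fix x0 r assume r: "0 < r" and inside: "ball x0 (3 * r) \<Subset> \<Omega>"
    let ?S = "ball x0 (3 * r)"
    let ?N = "Linf_norm M ?S f"
    have S: "open ?S" "?S \<subseteq> \<Omega>"
      using inside closure_subset[of ?S] by (auto simp: compactly_inside_def)
    \<comment> \<open>Local boundedness becomes boundedness on the compact closure, so the norm over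
      \<open>?S\<close> is a genuine bound.\<close>
    have "bounded (f ` closure ?S)"
      by (rule locally_bounded_on_compact[OF assms(7)]) (use inside in \<open>auto simp: compactly_inside_def\<close>)
    then have bd: "bounded (f ` ?S)"
      by (rule bounded_subset) (intro image_mono closure_subset)
    have "x0 \<in> ?S" using r by simp
    from strongly_harmonic_abs_le_Linf_norm[OF M \<Omega> harm S bd this]
    have N: "0 \<le> ?N" by linarith
    have sub: "ball x (2 * r) \<subseteq> ?S" if "x \<in> ball x0 r" for x
    proof
      fix z assume "z \<in> ball x (2 * r)"
      then show "z \<in> ?S" using that dist_triangle[of x0 z x] by simp
    qed
    have cs: "ball x (2 * r) \<Subset> \<Omega>" if "x \<in> ball x0 r" for x
      using closure_mono[OF sub[OF that]] inside by (auto simp: compactly_inside_def compact_closure)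
    \<comment> \<open>The radius \<open>2 * r\<close> fits twice: balls of this radius about points
      of \<open>ball x0 r\<close> stay in \<open>?S\<close>, and any two points of
      \<open>ball x0 r\<close> are less than \<open>2 * r\<close> apart. So the estimate covers all
      pairs.\<close>
    have est: "\<bar>f x - f y\<bar> \<le> 3 * ?N * A * (dist x y / (2 * r)) powr \<delta>"
      if "x \<in> ball x0 r" "y \<in> ball x0 r" for x y
    proof (rule strongly_harmonic_holder[OF M \<Omega> harm S bd decay])
      show "dist x y < 2 * r" using that dist_triangle3[of x y x0] by simp
    qed (use r that sub cs in auto)
    define L where "L = 3 * ?N * A / (2 * r) powr \<delta>"
    have L: "0 \<le> L" using N A by (simp add: L_def)
    have lip: "\<bar>f x - f y\<bar> \<le> L * dist x y powr \<delta>" if "x \<in> ball x0 r" "y \<in> ball x0 r" for x y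
      using est[OF that] r by (simp add: L_def powr_divide)
    show "holder_continuous_on \<delta> (ball x0 r) f"
      unfolding holder_continuous_on_def using L lip by blast
    show "locally_lipschitz_on (ball x0 r) f" if "\<delta> = 1"
    proof -
      have "L-lipschitz_on (ball x0 r) f"
        using lip L that by (intro lipschitz_onI) (auto simp: dist_real_def)
      \<comment> \<open>The bound holds on all of \<open>ball x0 r\<close>, so the neighbourhood
        radius 1 is arbitrary.\<close>
      then have "L-lipschitz_on (ball x 1 \<inter> ball x0 r) f" for x
        by (rule lipschitz_on_subset) blast
      then show ?thesis unfolding locally_lipschitz_on_def by (meson zero_less_one)
    qed
    show "\<bar>f x - f y\<bar> \<le> 4 * 9 powr \<delta> * ?N * C ^ 3 * A * (dist x y / r) powr \<delta>"
      if "x \<in> ball x0 (r / 2)" "y \<in> ball x0 (r / 2)" for x y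
    proof -
      have "x \<in> ball x0 r" "y \<in> ball x0 r" using that r by auto
      note est[OF this]
      also have "3 * ?N * A * (dist x y / (2 * r)) powr \<delta>
          \<le> 4 * 9 powr \<delta> * ?N * C ^ 3 * A * (dist x y / r) powr \<delta>"
        by (rule holder_constant_mono)
           (use C A N r assms(3) in \<open>auto intro!: divide_left_mono\<close>)
      finally show ?thesis .
    qed
  next
    fix K :: "'a set" and \<C> \<eta> x y
    assume K: "compact K" "K \<Subset> \<Omega>" and bd: "bounded (f ` \<Omega>)"
      and leb: "lebesgue_number \<C> K \<eta>" and xy: "x \<in> K" "y \<in> K"
    let ?N = "Linf_norm M \<Omega> f"
    have K\<Omega>: "K \<subseteq> \<Omega>" using K(2) closure_subset by (fastforce simp: compactly_inside_def)
    have le: "\<bar>f z\<bar> \<le> ?N" if "z \<in> K" for z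
      using strongly_harmonic_abs_le_Linf_norm[OF M \<Omega> harm \<Omega> subset_refl bd] that K\<Omega> by blast
    have N: "0 \<le> ?N" using le[OF xy(1)] by linarith
    have two: "\<bar>f x - f y\<bar> \<le> 2 * ?N" using le[OF xy(1)] le[OF xy(2)] by linarith
    show "\<bar>f x - f y\<bar> \<le> 2 * (?N / \<eta> powr \<delta>) * dist x y powr \<delta>" if "\<eta> < dist x y"
    proof -
      have \<eta>: "0 < \<eta>" using leb by (simp add: lebesgue_number_def)
      \<comment> \<open>For points further apart than \<eta> this factor can be multiplied into the
        trivial bound \<open>2 * ?N\<close>.\<close>
      then have "1 \<le> (dist x y / \<eta>) powr \<delta>"
        using that assms(3) by (intro ge_one_powr_ge_zero) auto
      then have "2 * ?N * 1 \<le> 2 * ?N * (dist x y / \<eta>) powr \<delta>"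
        using N by (intro mult_left_mono) auto
      with two \<eta> show ?thesis by (simp add: powr_divide)
    qed
    show "\<bar>f x - f y\<bar> \<le> 4 * 9 powr \<delta> * ?N * C ^ 3 * A * (2 / boundary_dist K \<Omega>) powr \<delta>
        * dist x y powr \<delta>"
    \<comment> \<open>For the whole space \<open>boundary_dist\<close> is 0 and division by 0 gives
      0, so the right-hand side vanishes and \<open>f\<close> has to be constant.\<close>
    proof (cases "\<Omega> = UNIV")
      case True
      then have "f x = f y"
        using strongly_harmonic_bounded_UNIV_const[OF M decay] harm bd by blast
      then show ?thesis using N A C by simp
    next
      case False
      define D where "D = boundary_dist K \<Omega>"
      \<comment> \<open>A compact set and a disjoint closed set, both nonempty, have positive
        distance.\<close>
      have "D \<noteq> 0" unfolding D_def boundary_dist_def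
        using setdist_eq_0_compact_closed[OF K(1), of "- \<Omega>"] \<Omega> False xy(1) K\<Omega> by auto
      then have D: "0 < D" by (simp add: D_def boundary_dist_def less_le)
      \<comment> \<open>Half the distance keeps even the closed balls inside \<Omega>, as compact
        inclusion requires. This radius is the source of the 2 in
        \<open>2 / boundary_dist K \<Omega>\<close>.\<close>
      have ins: "cball z (D / 2) \<subseteq> \<Omega>" if "z \<in> K" for z
      proof
        fix w assume w: "w \<in> cball z (D / 2)"
        have "w \<in> - \<Omega> \<Longrightarrow> D \<le> dist z w"
          unfolding D_def boundary_dist_def using that by (intro setdist_le_dist)
        then show "w \<in> \<Omega>" using w D by (cases "w \<in> \<Omega>") auto
      qed
      have "\<bar>f x - f y\<bar> \<le> 3 * ?N * A * (dist x y / (D / 2)) powr \<delta>"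
      proof (cases "dist x y < D / 2")
        case True
        show ?thesis
        proof (rule strongly_harmonic_holder[OF M \<Omega> harm \<Omega> subset_refl bd decay _ True])
          show "ball x (D / 2) \<Subset> \<Omega>" "ball y (D / 2) \<Subset> \<Omega>"
            using ins xy by (auto intro!: ball_compactly_inside)
          show "ball x (D / 2) \<subseteq> \<Omega>" "ball y (D / 2) \<subseteq> \<Omega>"
            using ins xy ball_subset_cball by (meson order_trans)+
        qed (use D in simp)
      next
        case False
        \<comment> \<open>For distant points the right-hand side is at least \<open>3 * ?N\<close>,
          which exceeds the trivial bound \<open>2 * ?N\<close> or equals it when \<open>?N\<close>
          is 0.\<close>
        then have "1 \<le> (dist x y / (D / 2)) powr \<delta>"
          using D assms(3) by (intro ge_one_powr_ge_zero) auto
        then have "1 * 1 \<le> A * (dist x y / (D / 2)) powr \<delta>"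
          using A by (intro mult_mono) auto
        then have "3 * ?N * 1 \<le> 3 * ?N * (A * (dist x y / (D / 2)) powr \<delta>)"
          using N by (intro mult_left_mono) auto
        with two N show ?thesis by (simp add: mult.assoc)
      qed
      also have "\<dots> \<le> 4 * 9 powr \<delta> * ?N * C ^ 3 * A * (dist x y / (D / 2)) powr \<delta>"
        by (rule holder_constant_mono) (use C A N D assms(3) in auto)
      also have "dist x y / (D / 2) = 2 / D * dist x y" by simp
      also have "(2 / D * dist x y) powr \<delta> = (2 / D) powr \<delta> * dist x y powr \<delta>"
        by (rule powr_mult)
      finally show ?thesis unfolding D_def by (simp add: mult.assoc)
    qed
  }
qed

end
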